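(* Let $(X,\triangleright)$ be a quasi rack and assume that $L^0_x(x)=x$ for all $x\in X$. Then the derived map $r_\triangleright:X\times X\to X\times X$, $r_\triangleright(x,y)=\left(L^0_x(y),\,L_y(x)\right)$, associated to $(X,\triangleright)$ is a quasi bijective and quasi non-degenerate solution.
   Context: Juxtaposition of maps denotes composition, $(fg)(x)=f(g(x))$. For a map $f:Z\to Z$ on a set $Z$, a relative inverse of $f$ is a map $f^-:Z\to Z$ with $ff^-f=f$, $f^-ff^-=f^-$, $ff^-=f^-f$; it is unique if it exists, and $f^0:=ff^-=f^-f$. A (left) shelf $(X,\triangleright)$ is a set $X$ with a binary operation such that $x\triangleright(y\triangleright z)=(x\triangleright y)\triangleright(x\triangleright z)$ for all $x,y,z$; write $L_x(y)=x\triangleright y$. A quasi rack is a shelf such that every $L_x$ has a relative inverse $L_x^-$ and $L_x^0L_y=L_yL_x^0$ for all $x,y\in X$, where $L^0_x=L_xL_x^-=L_x^-L_x$. A solution is a pair $(X,r)$ with $r:X\times X\to X\times X$ satisfying $(r\times\mathrm{id}_X)(\mathrm{id}_X\times r)(r\times\mathrm{id}_X)=(\mathrm{id}_X\times r)(r\times\mathrm{id}_X)(\mathrm{id}_X\times r)$; write $r(x,y)=(\lambda_x(y),\rho_y(x))$. It is quasi bijective if there exists a (necessarily unique) solution $(X,r^-)$ with $rr^-r=r$, $r^-rr^-=r^-$ and $r^-r=rr^-$. It is quasi left non-degenerate if every $\lambda_x$ has a relative inverse $\lambda_x^-$ and $\lambda_x^0\lambda_y=\lambda_y\lambda_x^0$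 for all $x,y$; quasi right non-degenerate if every $\rho_x$ has a relative inverse $\rho_x^-$ and $\rho_x^0\rho_y=\rho_y\rho_x^0$ for all $x,y$; quasi non-degenerate if both. *)

theory Defs
  imports Main
begin

text \<open>
  The underlying set of a shelf or of a solution is the universe of a type.
\<close>

section \<open>Relative inverses of maps\<close>

definition is_rel_inverse :: "('z \<Rightarrow> 'z) \<Rightarrow> ('z \<Rightarrow> 'z) \<Rightarrow> bool" where
  "is_rel_inverse f g \<longleftrightarrow> f \<circ> g \<circ> f = f \<and> g \<circ> f \<circ> g = g \<and> f \<circ> g = g \<circ> f"

definition has_rel_inverse :: "('z \<Rightarrow> 'z) \<Rightarrow> bool" where
  "has_rel_inverse f \<longleftrightarrow> (\<exists>g. is_rel_inverse f g)"

text \<open>The map \<open>f\<^sup>-\<close>; only meaningful if \<open>f\<close> has a relative inverse.\<close>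

definition rel_inverse :: "('z \<Rightarrow> 'z) \<Rightarrow> 'z \<Rightarrow> 'z" where
  "rel_inverse f = (THE g. is_rel_inverse f g)"

text \<open>The idempotent \<open>f\<^sup>0\<close>.\<close>

definition rel_idem :: "('z \<Rightarrow> 'z) \<Rightarrow> 'z \<Rightarrow> 'z" where
  "rel_idem f = f \<circ> rel_inverse f"

lemma is_rel_inverse_unique:
  assumes "is_rel_inverse f g" and "is_rel_inverse f h"
  shows "g = h"
proof
  fix x
  have f: "f (g (f y)) = f y" "g (f (g y)) = g y" "f (g y) = g (f y)"
          "f (h (f y)) = f y" "h (f (h y)) = h y" "f (h y) = h (f y)" for y
    using assms unfolding is_rel_inverse_def fun_eq_iff o_apply by blast+
  have e: "g (f y) = h (f y)" for y
    by (metis f)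
  show "g x = h x"
    by (metis e f)
qed

lemma is_rel_inverse_rel_inverse:
  assumes "has_rel_inverse f"
  shows "is_rel_inverse f (rel_inverse f)"
proof -
  have "\<exists>!g. is_rel_inverse f g"
    using assms is_rel_inverse_unique unfolding has_rel_inverse_def by blast
  then show ?thesis
    unfolding rel_inverse_def by (rule theI')
qed

section \<open>Shelves and quasi racks\<close>

text \<open>For \<open>L :: 'a \<Rightarrow> 'a \<Rightarrow> 'a\<close>, \<open>L x y\<close> is \<open>x \<triangleright> y\<close> and
  the partial application \<open>L x\<close> is the left translation \<open>L\<^sub>x\<close>.\<close>

definition shelf :: "('a \<Rightarrow> 'a \<Rightarrow> 'a) \<Rightarrow> bool" where
  "shelf L \<longleftrightarrow> (\<forall>x y z. L x (L y z) = L (L x y) (L x z))"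

definition quasi_rack :: "('a \<Rightarrow> 'a \<Rightarrow> 'a) \<Rightarrow> bool" where
  "quasi_rack L \<longleftrightarrow> shelf L \<and> (\<forall>x. has_rel_inverse (L x)) \<and>
     (\<forall>x y. rel_idem (L x) \<circ> L y = L y \<circ> rel_idem (L x))"

section \<open>Set-theoretic solutions\<close>

text \<open>\<open>r \<times> id\<close> and \<open>id \<times> r\<close> on triples; \<open>(x, y, z)\<close> is \<open>(x, (y, z))\<close>,
  whence the asymmetry.\<close>

definition r_times_id :: "('a \<times> 'a \<Rightarrow> 'a \<times> 'a) \<Rightarrow> 'a \<times> 'a \<times> 'a \<Rightarrow> 'a \<times> 'a \<times> 'a" where
  "r_times_id r = (\<lambda>(x, y, z). (fst (r (x, y)), snd (r (x, y)), z))"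

definition id_times_r :: "('a \<times> 'a \<Rightarrow> 'a \<times> 'a) \<Rightarrow> 'a \<times> 'a \<times> 'a \<Rightarrow> 'a \<times> 'a \<times> 'a" where
  "id_times_r r = (\<lambda>(x, y, z). (x, r (y, z)))"

definition solution :: "('a \<times> 'a \<Rightarrow> 'a \<times> 'a) \<Rightarrow> bool" where
  "solution r \<longleftrightarrow>
     r_times_id r \<circ> id_times_r r \<circ> r_times_id r = id_times_r r \<circ> r_times_id r \<circ> id_times_r r"

text \<open>\<open>r (x, y) = (\<lambda>\<^sub>x y, \<rho>\<^sub>y x)\<close>: the index of \<open>\<rho>\<close> is the second component.\<close>

definition lam :: "('a \<times> 'a \<Rightarrow> 'a \<times> 'a) \<Rightarrow> 'a \<Rightarrow> 'a \<Rightarrow> 'a" where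
  "lam r x y = fst (r (x, y))"

definition rho :: "('a \<times> 'a \<Rightarrow> 'a \<times> 'a) \<Rightarrow> 'a \<Rightarrow> 'a \<Rightarrow> 'a" where
  "rho r y x = snd (r (x, y))"

definition quasi_bijective :: "('a \<times> 'a \<Rightarrow> 'a \<times> 'a) \<Rightarrow> bool" where
  "quasi_bijective r \<longleftrightarrow> (\<exists>s. solution s \<and> is_rel_inverse r s)"

definition quasi_left_nondegenerate :: "('a \<times> 'a \<Rightarrow> 'a \<times> 'a) \<Rightarrow> bool" where
  "quasi_left_nondegenerate r \<longleftrightarrow> (\<forall>x. has_rel_inverse (lam r x)) \<and>
     (\<forall>x y. rel_idem (lam r x) \<circ> lam r y = lam r y \<circ> rel_idem (lam r x))"

definition quasi_right_nondegenerate :: "('a \<times> 'a \<Rightarrow> 'a \<times> 'a) \<Rightarrow> bool" where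
  "quasi_right_nondegenerate r \<longleftrightarrow> (\<forall>x. has_rel_inverse (rho r x)) \<and>
     (\<forall>x y. rel_idem (rho r x) \<circ> rho r y = rho r y \<circ> rel_idem (rho r x))"

definition quasi_nondegenerate :: "('a \<times> 'a \<Rightarrow> 'a \<times> 'a) \<Rightarrow> bool" where
  "quasi_nondegenerate r \<longleftrightarrow> quasi_left_nondegenerate r \<and> quasi_right_nondegenerate r"

definition derived_map :: "('a \<Rightarrow> 'a \<Rightarrow> 'a) \<Rightarrow> 'a \<times> 'a \<Rightarrow> 'a \<times> 'a" where
  "derived_map L = (\<lambda>(x, y). (rel_idem (L x) y, L y x))"

end

theory Submission
  imports Defs
begin

text \<open>
  Write \<open>E x\<close> for \<open>L\<^sub>x\<^sup>0\<close> and \<open>M x\<close> for \<open>L\<^sub>x\<^sup>-\<close>. The \<open>E y\<close> are idempotents that commute with all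
  translations, and on the image of \<open>E y\<close> the translation \<open>L y\<close> is invertible, so there the
  self-distributivity \<open>L y \<circ> L x = L (L y x) \<circ> L y\<close> says that \<open>L (L y x)\<close> is the conjugate of \<open>L x\<close> by
  \<open>L y\<close>. Conjugation does not change a central idempotent, and \<open>L y x = L y (E y x)\<close>; hence
  \<^item> \<open>E (L y x) \<circ> E y = E x \<circ> E y\<close> (lemma \<open>idem_translate\<close>),
  \<^item> \<open>L (E y x) \<circ> E y = L x \<circ> E y\<close>, and likewise for \<open>E\<close> and \<open>M\<close> (lemmas \<open>L_idem\<close>, \<open>E_idem\<close>, \<open>M_idem\<close>).

  The hypothesis \<open>E x x = x\<close> serves to create the factors \<open>E y\<close> which these rules need:
  an argument \<open>y\<close> may be read as \<open>E y y\<close>, and the factor moved to where it is wanted. With this,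
  the three coordinates of the braid equation become short computations.

  For quasi bijectivity, the relative inverse of \<open>(x, y) \<mapsto> (E x y, L y x)\<close> is
  \<open>(x, y) \<mapsto> (M x y, E y x)\<close>, with idempotent \<open>(x, y) \<mapsto> (E y x, E x y)\<close>. That this is again a solution
  needs no second computation: the maps \<open>M x\<close> form a quasi rack with the same idempotents
  (lemma \<open>quasi_rack_dual\<close>), and the relative inverse is its derived map conjugated by the flip.
  Finally \<open>\<lambda>\<^sub>x = E x\<close> and \<open>\<rho>\<^sub>y = L y\<close>, so non-degeneracy is read off from the axioms of a quasi rack.
\<close>

section \<open>Relative inverses and intertwining maps\<close>

lemma is_rel_inverse_sym: "is_rel_inverse f g \<Longrightarrow> is_rel_inverse g f"
  by (metis is_rel_inverse_def)

lemma rel_inverse_eqI: "is_rel_inverse f g \<Longrightarrow> rel_inverse f = g"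
  using is_rel_inverse_unique is_rel_inverse_rel_inverse has_rel_inverse_def by blast

lemma is_rel_inverseD:
  assumes "is_rel_inverse f g"
  shows "f (g (f y)) = f y" "g (f (g y)) = g y" "f (g y) = g (f y)"
  using assms unfolding is_rel_inverse_def fun_eq_iff o_apply by blast+

lemma has_rel_inverse_rel_inverse:
  assumes "has_rel_inverse f"
  shows "has_rel_inverse (rel_inverse f)" "rel_inverse (rel_inverse f) = f"
    "rel_idem (rel_inverse f) = rel_idem f"
proof -
  have i: "is_rel_inverse f (rel_inverse f)"
    using assms by (rule is_rel_inverse_rel_inverse)
  note i' = is_rel_inverse_sym[OF i]
  show "has_rel_inverse (rel_inverse f)"
    using i' has_rel_inverse_def by blast
  show *: "rel_inverse (rel_inverse f) = f"
    using i' by (rule rel_inverse_eqI)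
  show "rel_idem (rel_inverse f) = rel_idem f"
    using i by (simp add: rel_idem_def * is_rel_inverse_def)
qed

text \<open>
  All facts about relative inverses in quasi racks come from here: with \<open>f = f'\<close> it says that the
  maps commuting with \<open>f\<close> commute with \<open>f\<^sup>-\<close> and \<open>f\<^sup>0\<close>; with \<open>h\<close> a translation it transports
  self-distributivity to the relative inverses. The idempotents \<open>g \<circ> f\<close> and \<open>g' \<circ> f'\<close> come first:
  both \<open>h \<circ> g \<circ> f\<close> and \<open>g' \<circ> f' \<circ> h\<close> agree with \<open>g' \<circ> f' \<circ> h \<circ> g \<circ> f\<close>.
\<close>

lemma intertwine_rel_inverse:
  assumes f: "is_rel_inverse f g" and f': "is_rel_inverse f' g'"
    and h: "\<And>x. h (f x) = f' (h x)"
  shows "h (g (f x)) = g' (f' (h x))" and "h (g x) = g' (h x)"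
proof -
  note F = is_rel_inverseD[OF f] and F' = is_rel_inverseD[OF f']
  have e: "h (g (f x)) = g' (f' (h x))" for x
  proof -
    have "h (g (f x)) = f' (h (g x))"
      using F(3) h by metis
    then have "h (g (f x)) = g' (f' (h (g (f x))))"
      using F' by metis
    also have "\<dots> = g' (h (f (g (f x))))"
      by (simp only: h)
    also have "\<dots> = g' (f' (h x))"
      by (simp only: F(1) h)
    finally show ?thesis .
  qed
  then show "h (g (f x)) = g' (f' (h x))" .
  have "h (g x) = h (g (f (g x)))"
    by (simp only: F(2))
  also have "\<dots> = g' (h (f (g x)))"
    by (simp only: e h)
  also have "\<dots> = g' (g' (f' (h x)))"
    by (simp only: F(3) e)
  also have "\<dots> = g' (h x)"
    using F' by metis
  finally show "h (g x) = g' (h x)" .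
qed

section \<open>Translations and idempotents of a quasi rack\<close>

locale quasi_rack_structure =
  fixes L :: "'a \<Rightarrow> 'a \<Rightarrow> 'a"
  assumes quasi_rack: "quasi_rack L"
begin

definition M :: "'a \<Rightarrow> 'a \<Rightarrow> 'a" where
  "M x = rel_inverse (L x)"

definition E :: "'a \<Rightarrow> 'a \<Rightarrow> 'a" where
  "E x = rel_idem (L x)"

lemma shelf: "L x (L y z) = L (L x y) (L x z)"
  using quasi_rack unfolding quasi_rack_def shelf_def by blast

lemma has_rel_inverse_L: "has_rel_inverse (L x)"
  using quasi_rack unfolding quasi_rack_def by blast

lemma is_rel_inverse_L: "is_rel_inverse (L x) (M x)"
  unfolding M_def using has_rel_inverse_L by (rule is_rel_inverse_rel_inverse)

lemma L_M: "L x (M x z) = E x z" and M_L: "M x (L x z) = E x z"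
  using is_rel_inverseD(3)[OF is_rel_inverse_L] by (simp_all add: E_def M_def rel_idem_def)

lemma E_absorb [simp]:
  "E x (L x z) = L x z" "L x (E x z) = L x z" "E x (M x z) = M x z" "M x (E x z) = M x z"
  "E x (E x z) = E x z"
  using is_rel_inverseD[OF is_rel_inverse_L] L_M M_L by metis+

lemma E_L: "E x (L y z) = L y (E x z)"
  using quasi_rack unfolding quasi_rack_def E_def fun_eq_iff o_apply by blast

lemma E_M: "E x (M y z) = M y (E x z)"
  by (rule intertwine_rel_inverse(2)[where h = "E x", OF is_rel_inverse_L is_rel_inverse_L E_L])

lemma E_E: "E x (E y z) = E y (E x z)"
  by (metis E_L E_M L_M)

text \<open>Conjugation by \<open>L y\<close> fixes every idempotent \<open>E x\<close>, because \<open>E x\<close> commutes with \<open>L y\<close>.\<close>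

lemma idem_translate: "E (L y x) (E y z) = E x (E y z)"
proof -
  have "L y (M x (L x w)) = M (L y x) (L (L y x) (L y w))" for w
    by (rule intertwine_rel_inverse(1)[where h = "L y", OF is_rel_inverse_L is_rel_inverse_L shelf])
  then have "E (L y x) (L y w) = L y (E x w)" for w
    by (simp only: M_L)
  then show ?thesis
    by (metis E_L L_M)
qed

text \<open>
  On the image of \<open>E y\<close>, both sides are conjugate under \<open>L y\<close> to the translation by the one element
  \<open>L y (E y x) = L y x\<close>.
\<close>

lemma L_idem: "L (E y x) (E y z) = L x (E y z)"
proof -
  have "L y (L (E y x) z) = L y (L x z)"
    by (metis shelf E_absorb(2))
  then have "E y (L (E y x) z) = E y (L x z)"
    by (metis M_L)
  then show ?thesis
    by (simp add: E_L)
qed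

lemma E_idem: "E (E y x) (E y z) = E x (E y z)"
  and M_idem: "M (E y x) (E y z) = M x (E y z)"
proof -
  have h: "E y (L (E y x) w) = L x (E y w)" for w
    by (simp add: E_L L_idem)
  note i = intertwine_rel_inverse[where h = "E y", OF is_rel_inverse_L is_rel_inverse_L h]
  show "E (E y x) (E y z) = E x (E y z)"
    using i(1)[of z] by (simp add: M_L E_E)
  show "M (E y x) (E y z) = M x (E y z)"
    using i(2)[of z] by (simp add: E_M)
qed

section \<open>The dual quasi rack\<close>

text \<open>
  With \<open>M x y\<close> in place of the translated element, self-distributivity reads
  \<open>L x \<circ> L (M x y) = L (E x y) \<circ> L x\<close>, and \<open>E x y\<close> may be replaced by \<open>y\<close> since it acts on
  the image of \<open>L x\<close>. Passing to relative inverses gives the claim.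
\<close>

lemma M_shelf: "M x (M y z) = M (M x y) (M x z)"
proof -
  have "L x (L (M x y) w) = L y (L x w)" for w
    by (metis shelf L_M L_idem E_absorb(1))
  then have "L x (M (M x y) w) = M y (L x w)" for w
    by (rule intertwine_rel_inverse(2)[where h = "L x", OF is_rel_inverse_L is_rel_inverse_L])
  then have "M x (L x (M (M x y) (M x z))) = M x (M y (E x z))"
    by (simp add: L_M)
  then show ?thesis
    by (metis M_L E_M E_absorb(3))
qed

lemma rel_idem_dual: "rel_idem (M x) = rel_idem (L x)"
  unfolding M_def using has_rel_inverse_L by (rule has_rel_inverse_rel_inverse(3))

lemma quasi_rack_dual: "quasi_rack M"
proof -
  have "has_rel_inverse (M x)" for x
    unfolding M_def using has_rel_inverse_L by (rule has_rel_inverse_rel_inverse(1))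
  moreover have "rel_idem (M x) \<circ> M y = M y \<circ> rel_idem (M x)" for x y
    using E_M by (simp add: rel_idem_dual fun_eq_iff E_def)
  ultimately show ?thesis
    using M_shelf unfolding quasi_rack_def shelf_def by blast
qed

end

section \<open>The derived solution\<close>

lemma solutionI:
  assumes "\<And>x y. r (x, y) = (a x y, b x y)"
    and "\<And>x y z. a (a x y) (a (b x y) z) = a x (a y z)"
    and "\<And>x y z. b (a x y) (a (b x y) z) = a (b x (a y z)) (b y z)"
    and "\<And>x y z. b (b x y) z = b (b x (a y z)) (b y z)"
  shows "solution r"
  using assms by (auto simp: solution_def r_times_id_def id_times_r_def fun_eq_iff)

lemma solution_flip:
  assumes "solution r"
  shows "solution (prod.swap \<circ> r \<circ> prod.swap)"
proof -
  let ?s = "prod.swap \<circ> r \<circ> prod.swap"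
  define t :: "'a \<times> 'a \<times> 'a \<Rightarrow> 'a \<times> 'a \<times> 'a" where "t = (\<lambda>(x, y, z). (z, y, x))"
  have tt: "t (t u) = u" for u
    by (cases u) (simp add: t_def)
  have conj: "(t \<circ> a \<circ> t) \<circ> (t \<circ> b \<circ> t) \<circ> (t \<circ> c \<circ> t) = t \<circ> (a \<circ> b \<circ> c) \<circ> t" for a b c
    by (simp add: fun_eq_iff tt)
  \<comment> \<open>Reversing triples exchanges the two sides of the braid equation.\<close>
  have 1: "r_times_id ?s = t \<circ> id_times_r r \<circ> t" and 2: "id_times_r ?s = t \<circ> r_times_id r \<circ> t"
    by (auto simp: r_times_id_def id_times_r_def t_def fun_eq_iff prod.swap_def split: prod.splits)
  show ?thesis
    using assms unfolding solution_def 1 2 conj by simp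
qed

locale idempotent_quasi_rack = quasi_rack_structure +
  assumes E_self [simp]: "E x x = x"
begin

lemma derived_map_apply: "derived_map L (x, y) = (E x y, L y x)"
  by (simp add: derived_map_def E_def)

lemma E_swap_fix [simp]: "E y (E x y) = E x y"
  using E_E[of y x y] by simp

lemma E_L_fix [simp]: "E y (L x y) = L x y"
  by (simp add: E_L)

lemma E_translate_fix: "E (L y x) (E x y) = E x y"
  using idem_translate[of y x "E x y"] by simp

lemma E_idem_fix: "E (E y x) (E x y) = E x y"
  using E_idem[of y x "E x y"] by simp

text \<open>
  The element \<open>L y x\<close> is thus also a translate by \<open>E x y\<close>. The braid equation applies translations
  and idempotents indexed by \<open>L y x\<close> together with ones indexed by \<open>E x y\<close>; this rule makes
  self-distributivity and \<open>idem_translate\<close> applicable to such a pair.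
\<close>

lemma L_idem_self: "L (E x y) x = L y x"
  using L_idem[of x y x] by simp

lemma E_braid: "E (E x y) (E (L y x) z) = E x (E y z)"
proof -
  have "E (E x y) (E (L y x) z) = E (L (E x y) x) (E (E x y) z)"
    by (simp only: L_idem_self) (rule E_E)
  also have "\<dots> = E (E x y) (E x z)"
    by (simp only: idem_translate) (rule E_E)
  also have "\<dots> = E x (E y z)"
    by (simp only: E_idem) (rule E_E)
  finally show ?thesis .
qed

text \<open>Both sides equal \<open>E x (L z y)\<close>.\<close>

lemma mixed_braid: "L (E (L y x) z) (E x y) = E (L (E y z) x) (L z y)"
proof -
  have "L (E (L y x) z) (E x y) = L z (E x y)"
    using L_idem[of "L y x" z "E x y"] by (simp only: E_translate_fix)
  moreover have "E (L (E y z) x) (L z y) = L z (E x y)"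
  proof -
    \<comment> \<open>\<open>L z y\<close> is fixed by \<open>E y\<close> and \<open>E z\<close>, hence by \<open>E (E y z)\<close>, which lets \<open>idem_translate\<close> apply.\<close>
    have "E (E y z) (L z y) = L z y"
      using E_idem[of y z "L z y"] by simp
    then have "E (L (E y z) x) (L z y) = E x (L z y)"
      using idem_translate[of "E y z" x "L z y"] by simp
    then show ?thesis
      by (simp add: E_L)
  qed
  ultimately show ?thesis
    by simp
qed

lemma L_braid: "L z (L y x) = L (L z y) (L (E y z) x)"
proof -
  have "L (L z y) (L (E y z) x) = L (E y z) (L y x)"
    by (simp only: L_idem_self shelf[of "E y z" y x])
  also have "\<dots> = L z (L y x)"
    using L_idem[of y z "L y x"] by simp
  finally show ?thesis
    by simp
qed

lemma solution_derived_map: "solution (derived_map L)"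
proof (rule solutionI[where a = E and b = "\<lambda>x y. L y x"])
  show "derived_map L (x, y) = (E x y, L y x)" for x y
    by (rule derived_map_apply)
qed (rule E_braid mixed_braid L_braid)+

definition derived_inverse :: "'a \<times> 'a \<Rightarrow> 'a \<times> 'a" where
  "derived_inverse = (\<lambda>(x, y). (M x y, E y x))"

lemma is_rel_inverse_derived_inverse: "is_rel_inverse (derived_map L) derived_inverse"
proof -
  let ?r = "derived_map L" and ?s = derived_inverse
  have rs: "?r (?s (x, y)) = (E y x, E x y)" for x y
  proof -
    have "E (M x y) (E y x) = E y x"
      using idem_translate[of x "M x y" "E y x"] by (simp add: L_M E_idem_fix)
    moreover have "L (E y x) (M x y) = E x y"
      using L_idem[of y x "M x y"] by (simp add: E_M L_M)
    ultimately show ?thesis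
      by (simp add: derived_map_apply derived_inverse_def)
  qed
  have sr: "?s (?r (x, y)) = (E y x, E x y)" for x y
  proof -
    have "M (E x y) (L y x) = E y x"
      using M_idem[of x y "L y x"] by (simp add: M_L)
    then show ?thesis
      by (simp add: derived_map_apply derived_inverse_def E_translate_fix)
  qed
  have rp: "?r (E y x, E x y) = ?r (x, y)" for x y
  proof -
    have "L (E x y) (E y x) = L y x"
      using L_idem[of x y "E y x"] by simp
    then show ?thesis
      by (simp add: derived_map_apply E_idem_fix)
  qed
  have sp: "?s (E y x, E x y) = ?s (x, y)" for x y
  proof -
    have "M (E y x) (E x y) = M x y"
      using M_idem[of y x "E x y"] by simp
    then show ?thesis
      by (simp add: derived_inverse_def E_idem_fix)
  qed
  show ?thesis
    unfolding is_rel_inverse_def by (auto simp: fun_eq_iff rs sr rp sp)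
qed

lemma solution_derived_inverse: "solution derived_inverse"
proof -
  interpret dual: idempotent_quasi_rack M
  proof unfold_locales
    show qr: "quasi_rack M"
      by (rule quasi_rack_dual)
    interpret d: quasi_rack_structure M
      by unfold_locales (rule qr)
    show "d.E x x = x" for x
      using E_self by (simp add: d.E_def rel_idem_dual E_def)
  qed
  have "derived_inverse = prod.swap \<circ> derived_map M \<circ> prod.swap"
    by (auto simp: fun_eq_iff derived_inverse_def derived_map_def rel_idem_dual E_def)
  then show ?thesis
    using solution_flip dual.solution_derived_map by metis
qed

lemma quasi_bijective_derived_map: "quasi_bijective (derived_map L)"
  unfolding quasi_bijective_def
  using solution_derived_inverse is_rel_inverse_derived_inverse by blast

lemma quasi_nondegenerate_derived_map: "quasi_nondegenerate (derived_map L)"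
proof -
  have lam: "lam (derived_map L) x = E x" and rho: "rho (derived_map L) x = L x" for x
    by (auto simp: lam_def rho_def derived_map_apply fun_eq_iff)
  have i: "is_rel_inverse (E x) (E x)" for x
    by (simp add: is_rel_inverse_def fun_eq_iff)
  have "has_rel_inverse (E x)" for x
    using i has_rel_inverse_def by blast
  moreover have "rel_idem (E x) = E x" for x
    by (simp add: rel_idem_def rel_inverse_eqI[OF i] fun_eq_iff)
  ultimately have "quasi_left_nondegenerate (derived_map L)"
    using E_E by (simp add: quasi_left_nondegenerate_def lam fun_eq_iff)
  moreover have "quasi_right_nondegenerate (derived_map L)"
    using quasi_rack by (simp add: quasi_right_nondegenerate_def quasi_rack_def rho)
  ultimately show ?thesis
    by (simp add: quasi_nondegenerate_def)
qed

end

theorem theorem2p22: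
  fixes L :: "'a \<Rightarrow> 'a \<Rightarrow> 'a"
  assumes "quasi_rack L"
    and "\<And>x. rel_idem (L x) x = x"
  shows "solution (derived_map L) \<and> quasi_bijective (derived_map L) \<and>
    quasi_nondegenerate (derived_map L)"
proof -
  interpret quasi_rack_structure L
    by unfold_locales (rule assms(1))
  interpret idempotent_quasi_rack L
    by unfold_locales (simp add: E_def assms(2))
  show ?thesis
    using solution_derived_map quasi_bijective_derived_map quasi_nondegenerate_derived_map by blast
qed

end
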